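(* Let $\lambda\neq0$. For integers $n\ge0$ and $m\in\mathbb{N}$ with $m\equiv1\pmod2$, \[ 2^{n-1}\bigl(E_{n,\lambda}(m)+E_{n,\lambda}\bigr)=\sum_{l=0}^{m-1}(-1)^l(2l+1)_{n,2\lambda}. \]
   Context: $(x)_{0,\lambda}=1$, $(x)_{k,\lambda}=x(x-\lambda)\cdots(x-(k-1)\lambda)$ for $k\ge1$; $e_\lambda^x(t)=(1+\lambda t)^{x/\lambda}=\sum_{k\ge0}(x)_{k,\lambda}\frac{t^k}{k!}$. Degenerate type 2 Euler polynomials: $\frac{2}{e_\lambda^{1/2}(t)+e_\lambda^{-1/2}(t)}e_\lambda^x(t)=\sum_{n\ge0}E_{n,\lambda}(x)\frac{t^n}{n!}$ (formal power series in $t$), and $E_{n,\lambda}=E_{n,\lambda}(0)$. *)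

theory Defs
  imports Complex_Main "HOL-Computational_Algebra.Formal_Power_Series"
begin

text \<open>
  Everything is formal in \<open>t\<close>, so the scalars may come from any field of characteristic zero;
  this covers both real and complex \<open>lam\<close> and \<open>x\<close>.
\<close>

definition deg_falling :: "'a::field_char_0 \<Rightarrow> 'a \<Rightarrow> nat \<Rightarrow> 'a" where
  "deg_falling lam x k = (\<Prod>i<k. x - of_nat i * lam)"

definition deg_exp :: "'a::field_char_0 \<Rightarrow> 'a \<Rightarrow> 'a fps" where
  "deg_exp lam x = Abs_fps (\<lambda>k. deg_falling lam x k / fact k)"

text \<open>For nonzero \<open>lam\<close> this series is \<open>(1 + lam t)\<close> raised to the power \<open>x / lam\<close>.\<close>

lemma deg_exp_eq_binomial:
  fixes lam x :: "'a::field_char_0"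
  assumes "lam \<noteq> 0"
  shows "deg_exp lam x = fps_binomial (x / lam) oo (fps_const lam * fps_X)"
proof (rule fps_ext)
  fix k
  have "(\<Prod>i<k. x - of_nat i * lam) = (\<Prod>i<k. lam * (x / lam - of_nat i))"
    using assms by (intro prod.cong) (auto simp: field_simps)
  also have "\<dots> = lam ^ k * (\<Prod>i<k. x / lam - of_nat i)"
    by (simp add: prod.distrib)
  finally show "fps_nth (deg_exp lam x) k = fps_nth (fps_binomial (x / lam) oo (fps_const lam * fps_X)) k"
    by (simp add: deg_exp_def deg_falling_def gbinomial_prod_rev atLeast0LessThan fps_compose_linear)
qed

text \<open>
  The value at \<open>x\<close> of the \<open>n\<close>-th degenerate type 2 Euler polynomial. The denominator has constant
  coefficient 2, so the quotient is by an invertible power series.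
\<close>

definition deg_euler2 :: "'a::field_char_0 \<Rightarrow> nat \<Rightarrow> 'a \<Rightarrow> 'a" where
  "deg_euler2 lam n x =
     fact n * fps_nth (fps_const 2 / (deg_exp lam (1/2) + deg_exp lam (-1/2)) * deg_exp lam x) n"

end

theory Submission
  imports Defs
begin

text \<open>
  Write \<open>e(x)\<close> for the degenerate exponential series, so that \<open>e(x + y) = e(x) e(y)\<close>. Multiplied
  by \<open>e(1/2) + e(-1/2)\<close>, the alternating sum of the series \<open>e(l + 1/2)\<close> over \<open>l < m\<close> telescopes
  to \<open>e(0) + e(m)\<close> for odd \<open>m\<close>. Dividing by \<open>e(1/2) + e(-1/2)\<close> and comparing coefficients gives
  the claim, once the falling factorials are scaled by 2.
\<close>

text \<open>In binomial form this is the exponent law for powers of \<open>1 + t\<close>;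
  substituting \<open>lam * t\<close> respects products.\<close>

lemma deg_exp_add:
  fixes lam x y :: "'a::field_char_0"
  assumes "lam \<noteq> 0"
  shows "deg_exp lam (x + y) = deg_exp lam x * deg_exp lam y"
  using assms
  by (simp add: deg_exp_eq_binomial add_divide_distrib fps_binomial_add_mult fps_compose_mult_distrib)

lemma deg_falling_scale: "deg_falling (c * lam) (c * x) n = c ^ n * deg_falling lam x n"
proof -
  have "deg_falling (c * lam) (c * x) n = (\<Prod>i<n. c * (x - of_nat i * lam))"
    unfolding deg_falling_def by (intro prod.cong) (auto simp: algebra_simps)
  then show ?thesis
    by (simp add: deg_falling_def prod.distrib)
qed

lemma fact_mult_deg_exp_nth: "fact n * fps_nth (deg_exp lam x) n = deg_falling lam x n"
  by (simp add: deg_exp_def)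

text \<open>The first factor turns \<open>e(l + 1/2)\<close> into \<open>e(l + 1) + e(l)\<close>, so
  neighbouring terms cancel.\<close>

lemma alternating_deg_exp_sum:
  fixes lam :: "'a::field_char_0"
  assumes "lam \<noteq> 0"
  shows "(deg_exp lam (1/2) + deg_exp lam (-1/2)) * (\<Sum>l<m. (-1) ^ l * deg_exp lam (of_nat l + 1/2))
       = deg_exp lam 0 - (-1) ^ m * deg_exp lam (of_nat m)"
proof (induction m)
  case (Suc m)
  have "deg_exp lam (1/2) * deg_exp lam (of_nat m + 1/2) = deg_exp lam (of_nat (Suc m))"
    by (simp add: ac_simps flip: deg_exp_add[OF assms])
  moreover have "deg_exp lam (-1/2) * deg_exp lam (of_nat m + 1/2) = deg_exp lam (of_nat m)"
    by (simp flip: deg_exp_add[OF assms])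
  ultimately have "(deg_exp lam (1/2) + deg_exp lam (-1/2)) * deg_exp lam (of_nat m + 1/2)
      = deg_exp lam (of_nat (Suc m)) + deg_exp lam (of_nat m)"
    by (simp only: distrib_right)
  then have "(deg_exp lam (1/2) + deg_exp lam (-1/2)) * ((-1) ^ m * deg_exp lam (of_nat m + 1/2))
      = (-1) ^ m * (deg_exp lam (of_nat (Suc m)) + deg_exp lam (of_nat m))"
    by (simp only: mult.left_commute)
  with Suc.IH show ?case
    by (simp add: distrib_left[of "_ + _"] distrib_left[of "(-1) ^ m"] del: of_nat_Suc)
qed simp

theorem theorem2p17:
  fixes lam :: "'a::field_char_0" and n m :: nat
  assumes "lam \<noteq> 0" and "odd m"
  shows "2 powi (int n - 1) * (deg_euler2 lam n (of_nat m) + deg_euler2 lam n 0)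
       = (\<Sum>l<m. (-1) ^ l * deg_falling (2 * lam) (of_nat (2 * l + 1)) n)"
proof -
  define D where "D = deg_exp lam (1/2) + deg_exp lam (-1/2)"
  define S where "S = (\<Sum>l<m. (-1) ^ l * deg_exp lam (of_nat l + 1/2))"
  have D: "fps_nth D 0 \<noteq> 0"
    by (simp add: D_def deg_exp_def deg_falling_def)
  \<comment> \<open>For odd \<open>m\<close> the sign \<open>- (-1) ^ m\<close> is
    \<open>+1\<close>, so \<open>D * S\<close> is \<open>e(0) + e(m)\<close>.\<close>
  have "fps_const 2 / D * (deg_exp lam (of_nat m) + deg_exp lam 0) = fps_const 2 * inverse D * (D * S)"
    using alternating_deg_exp_sum[OF assms(1), of m] assms(2) D
    by (simp add: D_def S_def fps_divide_unit add.commute)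
  also have "\<dots> = fps_const 2 * (inverse D * D) * S"
    by (simp only: mult.assoc)
  finally have "fps_const 2 / D * (deg_exp lam (of_nat m) + deg_exp lam 0) = fps_const 2 * S"
    by (simp add: inverse_mult_eq_1[OF D])
  then have "deg_euler2 lam n (of_nat m) + deg_euler2 lam n 0 = fact n * fps_nth (fps_const 2 * S) n"
    unfolding deg_euler2_def D_def by (metis distrib_left fps_add_nth)
  also have "\<dots> = 2 * (\<Sum>l<m. (-1) ^ l * deg_falling lam (of_nat l + 1/2) n)"
  proof -
    have "fps_nth ((-1) ^ l * deg_exp lam x) n = (-1) ^ l * fps_nth (deg_exp lam x) n" for l x
      \<comment> \<open>Splitting on parity reduces the series \<open>(-1) ^ l\<close> to
        \<open>1\<close> or \<open>-1\<close>.\<close>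
      by (cases "even l") auto
    then show ?thesis
      by (simp add: S_def fps_sum_nth sum_distrib_left mult.left_commute flip: fact_mult_deg_exp_nth)
  qed
  \<comment> \<open>The factor 2 from the generating function raises the exponent
    \<open>n - 1\<close>, which is -1 for \<open>n = 0\<close>, to \<open>n\<close>.\<close>
  finally have "2 powi (int n - 1) * (deg_euler2 lam n (of_nat m) + deg_euler2 lam n 0)
      = (\<Sum>l<m. (-1) ^ l * (2 ^ n * deg_falling lam (of_nat l + 1/2) n))"
    by (simp add: power_int_diff sum_distrib_left mult_ac)
  \<comment> \<open>Scaling by 2 sends \<open>l + 1/2\<close> to \<open>2 * l + 1\<close> and
    \<open>lam\<close> to \<open>2 * lam\<close>.\<close>
  also have "\<dots> = (\<Sum>l<m. (-1) ^ l * deg_falling (2 * lam) (of_nat (2 * l + 1)) n)"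
    by (simp add: distrib_left add.commute flip: deg_falling_scale)
  finally show ?thesis .
qed

end
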